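(* Fix an integer $m\ge1$. For $f\in C[0,1]$ and $n\ge1$ define $e_1(p)=f(p)-\mathbb{E}_p[f(\hat p_n)]$ and $e_j(p)=e_{j-1}(p)-\mathbb{E}_p[e_{j-1}(\hat p_n)]$ for $j\ge2$, where $n\hat p_n\sim\mathrm{Binomial}(n,p)$. If $f(p)=-p\ln p$, then $\|e_m\|\asymp_m\frac1n\asymp_m\|e_1\|$. If $f(p)=p^\alpha$ with $0<\alpha<1$, then $\|e_m\|\asymp_{m,\alpha}\frac1{n^\alpha}\asymp_{m,\alpha}\|e_1\|$.
   Context: Norms are supremum norms over $p\in[0,1]$; $0\ln0=0$. $e_m$ is the bias of the bootstrap bias corrected estimator after $m-1$ rounds; $\mathbb{E}_p[g(\hat p_n)]=\sum_{i=0}^ng(i/n)\binom nip^i(1-p)^{n-i}$. $a\asymp_\theta b$ means that $a\le Mb$ and $b\le Ma$ for all $n$, with a constant $M$ depending only on $\theta$. *)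

theory Defs
  imports "HOL-Probability.Probability"
begin

definition binom_expect :: "nat \<Rightarrow> (real \<Rightarrow> real) \<Rightarrow> real \<Rightarrow> real" where
  "binom_expect n g p =
     (\<Sum>i=0..n. g (real i / real n) * (real (n choose i) * p ^ i * (1 - p) ^ (n - i)))"

lemma binom_expect_eq_expectation:
  assumes "0 \<le> p" "p \<le> 1"
  shows "binom_expect n g p =
    measure_pmf.expectation (binomial_pmf n p) (\<lambda>i. g (real i / real n))"
proof -
  have "measure_pmf.expectation (binomial_pmf n p) (\<lambda>i. g (real i / real n)) =
    (\<Sum>i=0..n. pmf (binomial_pmf n p) i *\<^sub>R g (real i / real n))"
    using assms by (intro integral_measure_pmf) (auto simp: set_pmf_binomial_eq split: if_splits)
  then show ?thesis
    using assms by (simp add: binom_expect_def mult_ac)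
qed

text \<open>The bias \<open>e\<^sub>j\<close>; the convention \<open>e\<^sub>0 = f\<close> makes the recursion uniform,
  so that \<open>e\<^sub>1(p) = f(p) - E\<^sub>p[f]\<close>.\<close>

primrec bias :: "(real \<Rightarrow> real) \<Rightarrow> nat \<Rightarrow> nat \<Rightarrow> real \<Rightarrow> real" where
  "bias f n 0 = f"
| "bias f n (Suc j) = (\<lambda>p. bias f n j p - binom_expect n (bias f n j) p)"

definition sup_norm01 :: "(real \<Rightarrow> real) \<Rightarrow> real" where
  "sup_norm01 g = (SUP p\<in>{0..1}. \<bar>g p\<bar>)"

text \<open>Two-sided comparability over all sample sizes \<open>n \<ge> 1\<close>. The constant is chosen after
  every parameter occurring in the sequences and before \<open>n\<close>.\<close>

definition comparable :: "(nat \<Rightarrow> real) \<Rightarrow> (nat \<Rightarrow> real) \<Rightarrow> bool" where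
  "comparable a b \<longleftrightarrow> (\<exists>M>0. \<forall>n\<ge>1. a n \<le> M * b n \<and> b n \<le> M * a n)"

end

theory Submission
  imports Defs
begin

text \<open>Write \<open>B\<close> for the operator \<open>binom_expect n\<close>. It is positive and fixes affine functions.
  Upper bounds: \<open>e\<^sub>m\<close> is at most \<open>2\<^sup>m\<^sup>-\<^sup>1\<close> times \<open>e\<^sub>1\<close> in norm, and \<open>e\<^sub>1\<close> is controlled by
  sandwiching \<open>f\<close> between a tangent line and a parabola touching it at \<open>p\<close>, whose expectations
  are explicit.

  Lower bounds: evaluate \<open>e\<^sub>m\<close> at \<open>p = x / n\<close> with a small constant \<open>x\<close>. As \<open>B\<close> only sees
  the values on the grid \<open>i / n\<close>, where \<open>t\<^sup>\<alpha> \<le> n\<^sup>1\<^sup>-\<^sup>\<alpha> t\<close>, every iterate \<open>B\<^sup>k f\<close> is at most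
  \<open>n\<^sup>1\<^sup>-\<^sup>\<alpha> p = n\<^sup>-\<^sup>\<alpha> x\<close>, which is negligible against \<open>f p = n\<^sup>-\<^sup>\<alpha> x\<^sup>\<alpha>\<close>. For \<open>- p ln p\<close> one first
  subtracts the linear function \<open>p ln n\<close>, which does not change \<open>e\<^sub>m\<close>; the remainder
  \<open>- p ln (n p)\<close> is at most \<open>n p\<^sup>2\<close> in absolute value on the grid.\<close>

section \<open>Moments, linearity and positivity of the binomial expectation\<close>

text \<open>Gives access to the moment sums \<open>sum_k_Bernstein\<close> and
  \<open>sum_kk_Bernstein\<close>.\<close>

lemma binom_expect_Bernstein:
  "binom_expect n g p = (\<Sum>i\<le>n. g (real i / real n) * Bernstein n i p)"
  by (simp add: binom_expect_def Bernstein_def atMost_atLeast0)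

lemma binom_expect_const: "binom_expect n (\<lambda>t. c) p = c"
  by (simp add: binom_expect_Bernstein flip: sum_distrib_left)

lemma binom_expect_ident:
  assumes "n \<ge> 1"
  shows "binom_expect n (\<lambda>t. t) p = p"
proof -
  have "binom_expect n (\<lambda>t. t) p = (\<Sum>i\<le>n. real i * Bernstein n i p) / n"
    by (simp add: binom_expect_Bernstein sum_divide_distrib del: sum_k_Bernstein)
  then show ?thesis using assms by simp
qed

lemma binom_expect_square:
  assumes "n \<ge> 1"
  shows "binom_expect n (\<lambda>t. t\<^sup>2) p = p\<^sup>2 + p * (1 - p) / n"
proof -
  \<comment> \<open>Split \<open>i^2 = i (i - 1) + i\<close>, because the second factorial moment is
    the known one.\<close>
  have "binom_expect n (\<lambda>t. t\<^sup>2) p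
      = (\<Sum>i\<le>n. (real i * (real i - 1) * Bernstein n i p + real i * Bernstein n i p) / n\<^sup>2)"
    unfolding binom_expect_Bernstein
    by (intro sum.cong refl) (simp add: power2_eq_square field_simps)
  also have "\<dots> = (real n * (real n - 1) * p\<^sup>2 + n * p) / n\<^sup>2"
    by (simp only: sum_divide_distrib[symmetric] sum.distrib sum_kk_Bernstein sum_k_Bernstein)
  also have "\<dots> = p\<^sup>2 + p * (1 - p) / n"
    using assms by (simp add: field_simps power2_eq_square)
  finally show ?thesis .
qed

lemma binom_expect_add:
  "binom_expect n (\<lambda>t. f t + g t) p = binom_expect n f p + binom_expect n g p"
  by (simp add: binom_expect_Bernstein distrib_right sum.distrib)

lemma binom_expect_diff:
  "binom_expect n (\<lambda>t. f t - g t) p = binom_expect n f p - binom_expect n g p"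
  by (simp add: binom_expect_Bernstein left_diff_distrib sum_subtractf)

lemma binom_expect_cmult: "binom_expect n (\<lambda>t. c * f t) p = c * binom_expect n f p"
  by (simp add: binom_expect_Bernstein sum_distrib_left mult.assoc)

lemma binom_expect_uminus: "binom_expect n (\<lambda>t. - f t) p = - binom_expect n f p"
  by (simp add: binom_expect_Bernstein sum_negf)

text \<open>Settles the endpoint \<open>p = 0\<close>, where neither choice of \<open>f\<close> has
  a finite slope: the first bias vanishes there.\<close>

lemma binom_expect_zero: "binom_expect n g 0 = g 0"
proof -
  have "binom_expect n g 0 = (\<Sum>i\<in>{0}. g (real i / real n) * Bernstein n i 0)"
    unfolding binom_expect_Bernstein
    by (intro sum.mono_neutral_right) (auto simp: Bernstein_def)
  then show ?thesis by (simp add: Bernstein_def)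
qed

lemma binom_expect_mono:
  assumes "p \<in> {0..1}" "\<And>i. i \<le> n \<Longrightarrow> f (real i / real n) \<le> g (real i / real n)"
  shows "binom_expect n f p \<le> binom_expect n g p"
  unfolding binom_expect_Bernstein
  using assms by (intro sum_mono mult_right_mono Bernstein_nonneg) auto

lemma binom_expect_abs_le:
  assumes "p \<in> {0..1}" "\<And>i. i \<le> n \<Longrightarrow> \<bar>f (real i / real n)\<bar> \<le> g (real i / real n)"
  shows "\<bar>binom_expect n f p\<bar> \<le> binom_expect n g p"
proof -
  have "binom_expect n f p \<le> binom_expect n g p"
    using assms by (intro binom_expect_mono) (auto simp: abs_le_iff)
  moreover have "binom_expect n (\<lambda>t. - f t) p \<le> binom_expect n g p"
    using assms by (intro binom_expect_mono) (auto simp: abs_le_iff)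
  ultimately show ?thesis by (simp add: binom_expect_uminus abs_le_iff)
qed

lemma grid_in_unit: "i \<le> n \<Longrightarrow> real i / real n \<in> {0..1}"
  by (cases "n = 0") auto

section \<open>Iterated bias and reduction to pointwise bounds\<close>

text \<open>The linear term cancels in the first round, since \<open>binom_expect n\<close> fixes
  it; later rounds only see \<open>bias f n 1\<close>.\<close>

lemma bias_subtract_linear:
  assumes "n \<ge> 1"
  shows "bias (\<lambda>p. f p - c * p) n (Suc j) = bias f n (Suc j)"
proof (induction j)
  case 0
  show ?case
    using assms by (simp add: fun_eq_iff binom_expect_diff binom_expect_cmult binom_expect_ident)
next
  case (Suc j)
  then show ?case by (simp only: bias.simps(2)[of _ _ "Suc j"])
qed

text \<open>A round subtracts an average of grid values, so it at most doubles a uniform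
  bound.\<close>

lemma bias_abs_le:
  assumes "\<And>p. p \<in> {0..1} \<Longrightarrow> \<bar>bias f n 1 p\<bar> \<le> K" "p \<in> {0..1}"
  shows "\<bar>bias f n (Suc j) p\<bar> \<le> 2 ^ j * K"
  using assms(2)
proof (induction j arbitrary: p)
  case 0
  then show ?case using assms(1) by simp
next
  case (Suc j)
  have "\<bar>binom_expect n (bias f n (Suc j)) p\<bar> \<le> binom_expect n (\<lambda>t. 2 ^ j * K) p"
    using Suc by (intro binom_expect_abs_le Suc.IH grid_in_unit) auto
  moreover have "\<bar>bias f n (Suc j) p\<bar> \<le> 2 ^ j * K"
    using Suc by blast
  ultimately show ?case
    by (simp only: bias.simps(2)[of _ _ "Suc j"] binom_expect_const power_Suc)
qed

text \<open>Since \<open>g p\<close> is subtracted, \<open>g\<close> need only be dominated by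
  \<open>w\<close> on the grid, while \<open>p\<close> may lie off it. On the grid the iterate is at
  most \<open>3 ^ j * w\<close>, so the next round changes it by at most
  \<open>2 * 3 ^ j * w\<close>, and \<open>(3 ^ j - 1) + 2 * 3 ^ j = 3 ^ Suc j - 1\<close>.\<close>

lemma bias_sub_abs_le:
  assumes grid: "\<And>i. i \<le> n \<Longrightarrow> \<bar>g (real i / real n)\<bar> \<le> w (real i / real n)"
    and w: "\<And>p. p \<in> {0..1} \<Longrightarrow> binom_expect n w p \<le> 2 * w p"
    and p: "p \<in> {0..1}"
  shows "\<bar>bias g n j p - g p\<bar> \<le> (3 ^ j - 1) * w p"
  using p
proof (induction j arbitrary: p)
  case (Suc j)
  have "\<bar>binom_expect n (bias g n j) p\<bar> \<le> binom_expect n (\<lambda>t. 3 ^ j * w t) p"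
  proof (rule binom_expect_abs_le[OF Suc.prems])
    fix i assume i: "i \<le> n"
    show "\<bar>bias g n j (real i / real n)\<bar> \<le> 3 ^ j * w (real i / real n)"
      using Suc.IH[OF grid_in_unit[OF i]] grid[OF i] by (simp add: left_diff_distrib)
  qed
  also have "\<dots> \<le> 3 ^ j * (2 * w p)"
    using w[OF Suc.prems] by (simp add: binom_expect_cmult)
  finally show ?case
    using Suc.IH[OF Suc.prems] by (simp add: algebra_simps)
qed simp

lemma comparable_bias:
  assumes C: "C > 0" "\<And>n p. n \<ge> 1 \<Longrightarrow> p \<in> {0..1} \<Longrightarrow> \<bar>bias f n 1 p\<bar> \<le> C * s n"
    and c: "c > 0" "\<And>n. n \<ge> 1 \<Longrightarrow> \<exists>p\<in>{0..1}. c * s n \<le> \<bar>bias f n m p\<bar>"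
    and s: "\<And>n. n \<ge> 1 \<Longrightarrow> s n \<ge> 0" and m: "m \<ge> 1"
  shows "comparable (\<lambda>n. sup_norm01 (bias f n m)) s"
proof -
  obtain j where j: "m = Suc j" using m by (cases m) auto
  define M where "M = max (2 ^ j * C) (1 / c)"
  have M: "M > 0" "2 ^ j * C \<le> M" "1 / c \<le> M"
    using C c by (auto simp: M_def less_max_iff_disj)
  have "sup_norm01 (bias f n m) \<le> M * s n \<and> s n \<le> M * sup_norm01 (bias f n m)"
    if n: "n \<ge> 1" for n
  proof
    have bnd: "\<bar>bias f n m p\<bar> \<le> 2 ^ j * (C * s n)" if "p \<in> {0..1}" for p
      unfolding j using C(2)[OF n] that by (rule bias_abs_le)
    have "sup_norm01 (bias f n m) \<le> 2 ^ j * (C * s n)"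
      unfolding sup_norm01_def using bnd by (intro cSUP_least) auto
    also have "\<dots> \<le> M * s n"
      using mult_right_mono[OF M(2) s[OF n]] by (simp add: mult.assoc)
    finally show "sup_norm01 (bias f n m) \<le> M * s n" .
    obtain p where p: "p \<in> {0..1}" "c * s n \<le> \<bar>bias f n m p\<bar>" using c(2)[OF n] by blast
    \<comment> \<open>A real \<open>SUP\<close> is an upper bound only for a bounded family;
      \<open>bnd\<close> supplies boundedness.\<close>
    have "\<bar>bias f n m p\<bar> \<le> sup_norm01 (bias f n m)"
      unfolding sup_norm01_def using bnd p(1) by (intro cSUP_upper bdd_aboveI2) auto
    then have *: "c * s n \<le> sup_norm01 (bias f n m)" using p(2) by simp
    then have "s n \<le> 1 / c * sup_norm01 (bias f n m)" using c(1) by (simp add: field_simps)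
    also have "\<dots> \<le> M * sup_norm01 (bias f n m)"
      using * c(1) s[OF n] M(3) by (intro mult_right_mono) (auto intro: order_trans[rotated])
    finally show "s n \<le> M * sup_norm01 (bias f n m)" .
  qed
  then show ?thesis using M(1) unfolding comparable_def by blast
qed

lemma comparable_sym: "comparable a b \<Longrightarrow> comparable b a"
  unfolding comparable_def by blast

section \<open>Upper bounds for the first bias\<close>

text \<open>At \<open>p\<close> the expectation of \<open>t - p\<close> is zero and that of
  \<open>(t - p)^2\<close> is the variance \<open>p (1 - p) / n\<close>. Apply this to the line
  above \<open>f\<close> and the parabola below it.\<close>

lemma bias_1_bounds_tangent:
  assumes n: "n \<ge> 1" and p: "p \<in> {0..1}"
    and upper: "\<And>t. t \<in> {0..1} \<Longrightarrow> f t \<le> f p + a * (t - p)"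
    and lower: "\<And>t. t \<in> {0..1} \<Longrightarrow> f p + a * (t - p) - b * (t - p)\<^sup>2 \<le> f t"
  shows "0 \<le> bias f n 1 p" "bias f n 1 p \<le> b * (p * (1 - p) / n)"
proof -
  have "binom_expect n f p \<le> binom_expect n (\<lambda>t. (f p - a * p) + a * t) p"
    using p upper[OF grid_in_unit] by (intro binom_expect_mono) (auto simp: algebra_simps)
  then show "0 \<le> bias f n 1 p"
    using n by (simp add: binom_expect_add binom_expect_cmult binom_expect_const binom_expect_ident)
  have "binom_expect n (\<lambda>t. (f p - a * p - b * p\<^sup>2) + ((a + 2 * b * p) * t + (- b) * t\<^sup>2)) p
      \<le> binom_expect n f p"
    using p lower[OF grid_in_unit]
    by (intro binom_expect_mono) (auto simp: algebra_simps power2_eq_square)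
  then have "(f p - a * p - b * p\<^sup>2) + ((a + 2 * b * p) * p + (- b) * (p\<^sup>2 + p * (1 - p) / n))
      \<le> binom_expect n f p"
    by (simp only: binom_expect_add binom_expect_cmult binom_expect_const
      binom_expect_ident[OF n] binom_expect_square[OF n])
  then show "bias f n 1 p \<le> b * (p * (1 - p) / n)"
    by (simp add: algebra_simps power2_eq_square diff_divide_distrib add_divide_distrib)
qed

text \<open>The parabola with coefficient \<open>1 / p\<close> works because this factor cancels the
  \<open>p\<close> in the variance. Line and parabola both come from
  \<open>ln y \<le> y - 1\<close>, with \<open>y = p / t\<close> and
  \<open>y = t / p\<close>.\<close>

lemma entropy_bias_1_le:
  assumes n: "n \<ge> 1" and p: "p \<in> {0..1}"
  shows "\<bar>bias (\<lambda>p. - p * ln p) n 1 p\<bar> \<le> 1 * (1 / real n)"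
proof (cases "p = 0")
  case True
  then show ?thesis by (simp add: binom_expect_zero)
next
  case False
  with p have p0: "p > 0" by simp
  let ?f = "\<lambda>p::real. - p * ln p"
  have up: "?f t \<le> ?f p + (- ln p - 1) * (t - p)" if "t \<in> {0..1}" for t
  proof (cases "t = 0")
    case False
    with that have t: "t > 0" by simp
    have "t * (ln p - ln t) \<le> t * (p / t - 1)"
      using ln_le_minus_one[of "p / t"] t p0 by (intro mult_left_mono) (auto simp: ln_div)
    then show ?thesis using t by (simp add: algebra_simps)
  qed (use p0 in \<open>simp add: algebra_simps\<close>)
  have lo: "?f p + (- ln p - 1) * (t - p) - 1 / p * (t - p)\<^sup>2 \<le> ?f t" if "t \<in> {0..1}" for t
  proof -
    have "t * (ln t - ln p) \<le> t * (t / p - 1)"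
    proof (cases "t = 0")
      case False
      with that have t: "t > 0" by simp
      then show ?thesis
        using ln_le_minus_one[of "t / p"] p0 by (intro mult_left_mono) (auto simp: ln_div)
    qed simp
    moreover have "t * (t / p - 1) = 1 / p * (t - p)\<^sup>2 + (t - p)"
      using p0 by (simp add: field_simps power2_eq_square)
    ultimately show ?thesis by (simp add: algebra_simps)
  qed
  have "1 / p * (p * (1 - p) / n) \<le> 1 / n"
    using p p0 n by (simp add: field_simps)
  then show ?thesis
    using bias_1_bounds_tangent[OF n p up lo] by simp
qed

text \<open>Weighted AM-GM for \<open>y\<close> and \<open>1\<close>.\<close>

lemma powr_tangent_upper:
  fixes y \<alpha> :: real
  assumes "0 < \<alpha>" "\<alpha> < 1" "0 \<le> y"
  shows "y powr \<alpha> \<le> 1 + \<alpha> * (y - 1)"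
proof (cases "y = 0")
  case False
  then show ?thesis
    using Youngs_inequality_0[of \<alpha> "1 - \<alpha>" y 1] assms by (simp add: algebra_simps)
qed (use assms in simp)

text \<open>For \<open>y > 0\<close>, bound \<open>y powr (\<alpha> - 1)\<close> below by a line and
  multiply by \<open>y\<close>: the product is exactly the parabola. At \<open>y = 0\<close> both
  sides are zero.\<close>

lemma powr_parabola_lower:
  fixes y \<alpha> :: real
  assumes "0 < \<alpha>" "\<alpha> < 1" "0 \<le> y"
  shows "1 + \<alpha> * (y - 1) - (1 - \<alpha>) * (y - 1)\<^sup>2 \<le> y powr \<alpha>"
proof (cases "y = 0")
  case False
  with assms have y: "y > 0" by simp
  have "1 - (1 - \<alpha>) * (y - 1) \<le> 1 + (\<alpha> - 1) * ln y"
    using mult_left_mono[OF ln_le_minus_one[OF y], of "1 - \<alpha>"] assms by (simp add: algebra_simps)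
  also have "\<dots> \<le> y powr (\<alpha> - 1)"
    using exp_ge_add_one_self[of "(\<alpha> - 1) * ln y"] y by (simp add: powr_def)
  finally have "y * (1 - (1 - \<alpha>) * (y - 1)) \<le> y * y powr (\<alpha> - 1)"
    using y by (intro mult_left_mono) auto
  also have "\<dots> = y powr \<alpha>" using y by (simp add: powr_mult_base)
  finally show ?thesis by (simp add: algebra_simps power2_eq_square)
qed (use assms in simp)

text \<open>The parabola bound is of order \<open>p powr (\<alpha> - 1) / n\<close>, which blows up
  at zero. It is used only for \<open>p > 1 / n\<close>; below that, \<open>f p\<close> itself is
  small enough.\<close>

lemma powr_bias_1_le:
  assumes \<alpha>: "0 < \<alpha>" "\<alpha> < 1" and n: "n \<ge> 1" and p: "p \<in> {0..1}"
  shows "\<bar>bias (\<lambda>p. p powr \<alpha>) n 1 p\<bar> \<le> 1 * (1 / real n powr \<alpha>)"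
proof (cases "p = 0")
  case True
  then show ?thesis by (simp add: binom_expect_zero)
next
  case False
  with p have p0: "p > 0" by simp
  let ?f = "\<lambda>p::real. p powr \<alpha>"
  \<comment> \<open>Homogeneity reduces both estimates at \<open>p\<close> to those at
    \<open>1\<close>, with \<open>y = t / p\<close>.\<close>
  have f: "?f t = ?f p * (t / p) powr \<alpha>" if "t \<in> {0..1}" for t
    using p0 that by (simp add: powr_divide)
  have up: "?f t \<le> ?f p + (?f p * \<alpha> / p) * (t - p)" if t: "t \<in> {0..1}" for t
  proof -
    have "?f t \<le> ?f p * (1 + \<alpha> * (t / p - 1))"
      unfolding f[OF t] using powr_tangent_upper[OF \<alpha>, of "t / p"] t p0
      by (intro mult_left_mono) auto
    then show ?thesis using p0 by (simp add: field_simps)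
  qed
  have lo: "?f p + (?f p * \<alpha> / p) * (t - p) - (?f p * (1 - \<alpha>) / p\<^sup>2) * (t - p)\<^sup>2 \<le> ?f t"
    if t: "t \<in> {0..1}" for t
  proof -
    have "?f p * (1 + \<alpha> * (t / p - 1) - (1 - \<alpha>) * (t / p - 1)\<^sup>2) \<le> ?f t"
      unfolding f[OF t] using powr_parabola_lower[OF \<alpha>, of "t / p"] t p0
      by (intro mult_left_mono) auto
    moreover have "t / p - 1 = (t - p) / p" using p0 by (simp add: field_simps)
    ultimately show ?thesis by (simp add: algebra_simps power_divide)
  qed
  note bounds = bias_1_bounds_tangent[OF n p up lo]
  have "bias ?f n 1 p \<le> 1 / real n powr \<alpha>"
  proof (cases "p * n \<le> 1")
    case True
    have "binom_expect n (\<lambda>t. 0) p \<le> binom_expect n ?f p"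
      using p by (intro binom_expect_mono) auto
    then have "bias ?f n 1 p \<le> ?f p" by (simp add: binom_expect_const)
    also have "\<dots> \<le> (1 / n) powr \<alpha>"
      using True p0 n \<alpha> by (intro powr_mono2) (auto simp: field_simps)
    finally show ?thesis by (simp add: powr_divide)
  next
    case False
    have "bias ?f n 1 p \<le> ?f p * (1 - \<alpha>) / p\<^sup>2 * (p * (1 - p) / n)"
      by (rule bounds(2))
    also have "\<dots> = ((1 - \<alpha>) * (1 - p)) * (p powr (\<alpha> - 1) / n)"
      using p0 n by (simp add: powr_diff field_simps power2_eq_square)
    also have "\<dots> \<le> 1 * (p powr (\<alpha> - 1) / n)"
      using p \<alpha> by (intro mult_right_mono mult_le_one) auto
    also have "\<dots> \<le> (1 / n) powr (\<alpha> - 1) / n"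
      using False p0 n \<alpha>
      by (auto intro!: divide_right_mono powr_mono2' simp: field_simps)
    also have "\<dots> = 1 / real n powr \<alpha>"
      using n by (simp add: powr_diff powr_divide field_simps)
    finally show ?thesis .
  qed
  then show ?thesis using bounds(1) by simp
qed

section \<open>Lower bounds at a point of order \<open>1 / n\<close>\<close>

text \<open>The exponent in \<open>x\<close> makes \<open>- ln x\<close> exceed by one the factor
  \<open>2 * 3 ^ m\<close> that bounds the error; the surplus is \<open>x / n\<close>.\<close>

lemma entropy_bias_ge:
  fixes x :: real
  assumes n: "n \<ge> 1" and m: "m \<ge> 1" and x: "x = exp (- (2 * 3 ^ m + 1))"
  shows "\<exists>p\<in>{0..1}. x * (1 / real n) \<le> \<bar>bias (\<lambda>p. - p * ln p) n m p\<bar>"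
proof
  \<comment> \<open>\<open>n t^2\<close> alone dominates \<open>?g\<close> on the grid, but its
    expectation has the extra term \<open>p (1 - p)\<close>, too large near zero. The summand
    \<open>t\<close> absorbs it.\<close>
  let ?g = "\<lambda>p::real. - p * ln p - ln n * p" and ?w = "\<lambda>t::real. real n * t\<^sup>2 + t"
  have "(0::real) \<le> 3 ^ m" by simp
  then have "- (2 * 3 ^ m + 1) \<le> (0::real)" by linarith
  then have x01: "0 < x" "x \<le> 1" by (auto simp: x)
  show p: "x / n \<in> {0..1}" using x01 n by (auto simp: field_simps)
  have grid: "\<bar>?g (real i / real n)\<bar> \<le> ?w (real i / real n)" for i
  proof (cases "i = 0")
    case False
    have "?g (real i / real n) = - (real i / real n) * ln (real i)"
      using False n by (simp add: ln_div algebra_simps)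
    moreover have "real i / real n * ln (real i) \<le> real i / real n * real i"
      using ln_le_minus_one[of "real i"] False by (intro mult_left_mono) auto
    moreover have "real i / real n * real i = real n * (real i / real n)\<^sup>2"
      using n by (simp add: power2_eq_square)
    moreover have "0 \<le> real i / real n * ln (real i)" "0 \<le> real i / real n"
      using False by auto
    ultimately show ?thesis by linarith
  qed simp
  have w: "binom_expect n ?w p \<le> 2 * ?w p" if "p \<in> {0..1}" for p
  proof -
    have "binom_expect n ?w p = real n * p\<^sup>2 + p * (1 - p) + p"
      using n by (simp add: binom_expect_add binom_expect_cmult binom_expect_ident
        binom_expect_square field_simps)
    moreover have "p * (1 - p) \<le> p + real n * p\<^sup>2"
      using that by (intro add_increasing2) (auto simp: algebra_simps)
    ultimately show ?thesis by simp
  qed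
  have eq: "bias (\<lambda>p. - p * ln p) n m = bias ?g n m"
    using bias_subtract_linear[OF n, of "\<lambda>p. - p * ln p" "ln n" "m - 1"] m by simp
  have wx: "?w (x / n) = (x + 1) * (x / n)"
    using n by (simp add: power2_eq_square field_simps)
  have "?g (x / n) = - ln x * (x / n)"
    using n x01 by (simp add: ln_div algebra_simps)
  moreover have "- ln x = 2 * 3 ^ m + 1" by (simp add: x)
  ultimately have gx: "?g (x / n) = (2 * 3 ^ m + 1) * (x / n)" by metis
  have "(3 ^ m - 1) * ((x + 1) * (x / n)) \<le> 3 ^ m * (2 * (x / n))"
    using x01 by (intro mult_mono) auto
  then have "x * (1 / n) \<le> ?g (x / n) - (3 ^ m - 1) * ?w (x / n)"
    unfolding wx gx by (simp add: algebra_simps)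
  then show "x * (1 / n) \<le> \<bar>bias (\<lambda>p. - p * ln p) n m (x / n)\<bar>"
    using bias_sub_abs_le[OF grid w p, of m] unfolding eq by linarith
qed

text \<open>\<open>x\<close> solves \<open>3 ^ m * x = x powr \<alpha> / 2\<close>, so the error
  bound takes at most half of the main term. Here \<open>w\<close> is linear, hence fixed by the
  expectation.\<close>

lemma powr_bias_ge:
  fixes x :: real
  assumes \<alpha>: "0 < \<alpha>" "\<alpha> < 1" and n: "n \<ge> 1" and x: "x = (1 / (2 * 3 ^ m)) powr (1 / (1 - \<alpha>))"
  shows "\<exists>p\<in>{0..1}. x powr \<alpha> / 2 * (1 / real n powr \<alpha>) \<le> \<bar>bias (\<lambda>p. p powr \<alpha>) n m p\<bar>"
proof
  let ?g = "\<lambda>p::real. p powr \<alpha>" and ?w = "\<lambda>t::real. real n powr (1 - \<alpha>) * t"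
  have "(1::real) \<le> 3 ^ m" by simp
  then have "1 \<le> 2 * (3::real) ^ m" by linarith
  then have "1 / (2 * 3 ^ m) \<le> (1::real)" by simp
  then have x01: "0 < x" "x \<le> 1" using \<alpha> by (auto simp: x intro!: powr_le1)
  show p: "x / n \<in> {0..1}" using x01 n by (auto simp: field_simps)
  have grid: "\<bar>?g (real i / real n)\<bar> \<le> ?w (real i / real n)" for i
  proof (cases "i = 0")
    case False
    \<comment> \<open>Integrality of the rescaled grid enters here: the inequality needs
      \<open>i \<ge> 1\<close>.\<close>
    have "real i powr \<alpha> \<le> real i powr 1" using False \<alpha> by (intro powr_mono) auto
    then show ?thesis using n by (simp add: powr_divide powr_diff field_simps)
  qed simp
  have w: "binom_expect n ?w p \<le> 2 * ?w p" if "p \<in> {0..1}" for p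
    using n that by (simp add: binom_expect_cmult binom_expect_ident)
  have gx: "?g (x / n) = x powr \<alpha> * (1 / n powr \<alpha>)"
    using x01 by (simp add: powr_divide)
  have "x = x powr \<alpha> * x powr (1 - \<alpha>)" using x01 by (simp flip: powr_add)
  also have "x powr (1 - \<alpha>) = 1 / (2 * 3 ^ m)" using \<alpha> by (simp add: x powr_powr)
  finally have x': "3 ^ m * x = x powr \<alpha> / 2" by (simp add: field_simps)
  have "(3 ^ m - 1) * ?w (x / n) \<le> 3 ^ m * ?w (x / n)"
    using x01 by (intro mult_right_mono) auto
  also have "\<dots> = (3 ^ m * x) * (1 / n powr \<alpha>)"
    using n by (simp add: powr_diff field_simps)
  finally have "x powr \<alpha> / 2 * (1 / n powr \<alpha>) \<le> ?g (x / n) - (3 ^ m - 1) * ?w (x / n)"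
    unfolding x' gx by (simp add: algebra_simps)
  then show "x powr \<alpha> / 2 * (1 / n powr \<alpha>) \<le> \<bar>bias ?g n m (x / n)\<bar>"
    using bias_sub_abs_le[OF grid w p, of m] by linarith
qed

theorem corollary2:
  fixes m :: nat
  assumes "m \<ge> 1"
  shows
    "(comparable (\<lambda>n. sup_norm01 (bias (\<lambda>p. - p * ln p) n m)) (\<lambda>n. 1 / real n) \<and>
      comparable (\<lambda>n. 1 / real n) (\<lambda>n. sup_norm01 (bias (\<lambda>p. - p * ln p) n 1))) \<and>
     (\<forall>\<alpha>::real. 0 < \<alpha> \<and> \<alpha> < 1 \<longrightarrow>
      comparable (\<lambda>n. sup_norm01 (bias (\<lambda>p. p powr \<alpha>) n m)) (\<lambda>n. 1 / real n powr \<alpha>) \<and>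
      comparable (\<lambda>n. 1 / real n powr \<alpha>) (\<lambda>n. sup_norm01 (bias (\<lambda>p. p powr \<alpha>) n 1)))"
proof -
  \<comment> \<open>A general \<open>k\<close> serves both \<open>k = m\<close> and
    \<open>k = 1\<close>.\<close>
  have entropy: "comparable (\<lambda>n. sup_norm01 (bias (\<lambda>p. - p * ln p) n k)) (\<lambda>n. 1 / real n)"
    if "k \<ge> 1" for k
    by (rule comparable_bias[OF zero_less_one entropy_bias_1_le _ entropy_bias_ge[OF _ that refl]])
      (use that in auto)
  have power: "comparable (\<lambda>n. sup_norm01 (bias (\<lambda>p. p powr \<alpha>) n k)) (\<lambda>n. 1 / real n powr \<alpha>)"
    if "k \<ge> 1" "0 < \<alpha>" "\<alpha> < 1" for k and \<alpha> :: real
    by (rule comparable_bias[OF zero_less_one powr_bias_1_le[OF that(2,3)] _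
          powr_bias_ge[OF that(2,3) _ refl]])
      (use that in auto)
  show ?thesis
    using assms
    by (intro conjI allI impI entropy power comparable_sym[OF entropy] comparable_sym[OF power]) auto
qed

end
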